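(* Let $K$ be a field and let $\mathcal{P}\subset \mathbb{R}_{\ge 0}^n$ be an anti-blocking lattice polytope of dimension $n$, and let $\mathcal{P}^{\pm}=\{\varepsilon\mathbf{x} : \varepsilon\in\{-1,1\}^n,\ \mathbf{x}\in\mathcal{P}\}$. Then the toric ring $K[\mathcal{P}]$ is normal if and only if the toric ring $K[\mathcal{P}^{\pm}]$ is normal.
   Context: A lattice polytope is a convex polytope whose vertices have integer coordinates. A lattice polytope $\mathcal{P}\subset\mathbb{R}_{\ge0}^n$ of dimension $n$ is anti-blocking if for every $\mathbf{y}\in\mathcal{P}$ and every $\mathbf{x}\in\mathbb{R}^n$ with $0\le x_i\le y_i$ for all $i$, one has $\mathbf{x}\in\mathcal{P}$. For $\varepsilon=(\varepsilon_1,\dots,\varepsilon_n)\in\{-1,1\}^n$ and $\mathbf{x}\in\mathbb{R}^n$, $\varepsilon\mathbf{x}:=(\varepsilon_1x_1,\dots,\varepsilon_nx_n)$; $\mathcal{P}^{\pm}$ is then a convex lattice polytope. For a lattice polytope $\mathcal{Q}\subset\mathbb{R}^n$ with $\mathcal{Q}\cap\mathbb{Z}^n=\{\mathbf{a}_1,\dots,\mathbf{a}_m\}$, the toric ring $K[\mathcal{Q}]$ is the subalgebra of the Laurent polynomial ring $K[t_1^{\pm1},\dots,t_n^{\pm1},s]$ generated by $\mathbf{t}^{\mathbf{a}_1}s,\dots,\mathbf{t}^{\mathbf{a}_m}s$, where $\mathbf{t}^{\mathbf{a}}=t_1^{a_1}\cdots t_n^{a_n}$. *)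

theory Defs
  imports
    "HOL-Analysis.Analysis"
    "HOL-Library.Poly_Mapping"
    "HOL-Computational_Algebra.Fraction_Field"
    "HOL-Computational_Algebra.Polynomial"
begin

definition lattice_polytope :: "(real ^ 'n) set \<Rightarrow> bool" where
  "lattice_polytope P \<longleftrightarrow>
     polytope P \<and> (\<forall>v. v extreme_point_of P \<longrightarrow> (\<forall>i. v $ i \<in> \<int>))"

definition anti_blocking_lattice_polytope :: "(real ^ 'n) set \<Rightarrow> bool" where
  "anti_blocking_lattice_polytope P \<longleftrightarrow>
     lattice_polytope P \<and>
     aff_dim P = int CARD('n) \<and>
     (\<forall>x\<in>P. \<forall>i. 0 \<le> x $ i) \<and>
     (\<forall>y\<in>P. \<forall>x. (\<forall>i. 0 \<le> x $ i \<and> x $ i \<le> y $ i) \<longrightarrow> x \<in> P)"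

definition sign_reflections :: "(real ^ 'n) set \<Rightarrow> (real ^ 'n) set" where
  "sign_reflections P =
     {(\<chi> i. \<epsilon> $ i * x $ i) | \<epsilon> x. (\<forall>i. \<epsilon> $ i \<in> {-1, 1}) \<and> x \<in> P}"

text \<open>
  A Laurent polynomial in the variables \<open>t\<^sub>i\<close>, \<open>i :: 'n\<close>, is a finitely supported map from
  exponent vectors \<open>'n \<Rightarrow>\<^sub>0 int\<close> to coefficients, multiplied by convolution; \<open>s\<close> is the variable
  of the univariate polynomials over these. Polynomials in \<open>s\<close> suffice, since the exponent of
  \<open>s\<close> is never negative in a toric ring. The index type \<open>'n\<close> is linearly ordered
  (as \<open>{1..n}\<close> is) because the library instance of \<open>idom\<close> for \<open>poly_mapping\<close>
  needs an ordered exponent monoid; the ordering plays no other role.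
\<close>

type_synonym ('n, 'k) laurent = "('n \<Rightarrow>\<^sub>0 int) \<Rightarrow>\<^sub>0 'k"

definition const :: "'k \<Rightarrow> ('n::{finite,linorder}, 'k::field) laurent poly" where
  "const c = [:Poly_Mapping.single 0 c:]"

definition t_pow_s :: "('n::{finite,linorder} \<Rightarrow>\<^sub>0 int) \<Rightarrow> ('n, 'k::field) laurent poly" where
  "t_pow_s a = monom (Poly_Mapping.single a 1) 1"

definition lattice_points :: "(real ^ 'n) set \<Rightarrow> ('n \<Rightarrow>\<^sub>0 int) set" where
  "lattice_points Q = {a. (\<chi> i. of_int (Poly_Mapping.lookup a i)) \<in> Q}"

definition k_subalgebra :: "('n::{finite,linorder}, 'k::field) laurent poly set \<Rightarrow> bool" where
  "k_subalgebra A \<longleftrightarrow>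
     range const \<subseteq> A \<and> (\<forall>f\<in>A. \<forall>g\<in>A. f + g \<in> A \<and> f * g \<in> A)"

definition toric_ring ::
    "(real ^ 'n::{finite,linorder}) set \<Rightarrow> ('n, 'k::field) laurent poly set" where
  "toric_ring Q = k_subalgebra hull (t_pow_s ` lattice_points Q)"

text \<open>
  The field of fractions of a subring \<open>A\<close> of a domain is realised inside the field of
  fractions of that domain.
\<close>

definition embed_fract :: "'a::idom \<Rightarrow> 'a fract" where
  "embed_fract a = Fraction_Field.Fract a 1"

definition fractions_of :: "'a::idom set \<Rightarrow> 'a fract set" where
  "fractions_of A = {Fraction_Field.Fract a b | a b. a \<in> A \<and> b \<in> A \<and> b \<noteq> 0}"

definition integral_over :: "'a::comm_ring_1 set \<Rightarrow> 'a \<Rightarrow> bool" where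
  "integral_over A x \<longleftrightarrow>
     (\<exists>p. lead_coeff p = 1 \<and> (\<forall>i. coeff p i \<in> A) \<and> poly p x = 0)"

text \<open>
  Meant for subrings \<open>A\<close> of a domain, which are domains themselves.
\<close>

definition normal_domain :: "'a::idom set \<Rightarrow> bool" where
  "normal_domain A \<longleftrightarrow>
     (\<forall>x\<in>fractions_of A. integral_over (embed_fract ` A) x \<longrightarrow> x \<in> embed_fract ` A)"

end

theory Submission
  imports Defs
begin

text \<open>
  The toric ring \<open>K[Q]\<close> is spanned by the monomials \<open>t\<^sup>a s\<^sup>k\<close> with \<open>a\<close> a sum of \<open>k\<close> lattice points
  of \<open>Q\<close>. If \<open>Q\<close> contains the origin and the unit vectors, all \<open>t\<^sup>a s\<^sup>k\<close> lie in the field of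
  fractions, and \<open>K[Q]\<close> is normal iff this semigroup is saturated: \<open>(ma, mk) \<in> S\<close> with \<open>m > 0\<close>
  implies \<open>(a, k) \<in> S\<close>. For the direction from saturation to normality let \<open>f / g\<close> be integral.
  Then \<open>d f\<^sup>i \<in> g\<^sup>i K[Q]\<close> for some \<open>d \<noteq> 0\<close> and all \<open>i\<close>. Comparing leading terms, the exponent \<open>u\<close>
  of the leading term of \<open>f / g\<close> satisfies \<open>w + i u \<in> S\<close> for some \<open>w\<close> and all \<open>i\<close>, whence \<open>u \<in> S\<close>.
  The leading term can then be subtracted from \<open>f / g\<close>, and the division terminates because \<open>S\<close> has
  finitely many elements in each degree.

  An anti-blocking polytope contains the origin and the unit vectors, and sums of its lattice
  points form a downward closed set. As \<open>b\<close> is a lattice point of \<open>P\<^sup>\<plusminus>\<close> iff the vector \<open>\<bar>b\<bar>\<close> of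
  absolute values is one of \<open>P\<close>, downward closedness gives \<open>(a, k) \<in> S(P\<^sup>\<plusminus>)\<close> iff
  \<open>(\<bar>a\<bar>, k) \<in> S(P)\<close>, so the two semigroups are saturated simultaneously.
\<close>

section \<open>Sums of lattice points and Dickson's lemma\<close>

text \<open>Layer of degree \<open>l\<close> in the semigroup generated by the pairs (b, 1) with b
  in \<open>B\<close>. The summands form a multiset so that Dickson's lemma can compare two sums by
  inclusion.\<close>

definition fold_sums :: "'e::comm_monoid_add set \<Rightarrow> nat \<Rightarrow> 'e set" where
  "fold_sums B l = {sum_mset M | M. set_mset M \<subseteq> B \<and> size M = l}"

text \<open>The sum is the m-fold multiple of \<open>a\<close>. For a group \<open>'e\<close>, this
  is saturation in all of \<open>'e\<close>, which is saturation in the group generated by the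
  semigroup as soon as that group contains every pair (a, k).\<close>

definition saturated :: "(nat \<Rightarrow> 'e::comm_monoid_add set) \<Rightarrow> bool" where
  "saturated S \<longleftrightarrow> (\<forall>m k a. 0 < m \<longrightarrow> (\<Sum>j<m. a) \<in> S (m * k) \<longrightarrow> a \<in> S k)"

definition monomial_span :: "(nat \<Rightarrow> 'e set) \<Rightarrow> ('e \<Rightarrow>\<^sub>0 'k::zero) poly set" where
  "monomial_span S = {f. \<forall>l. Poly_Mapping.keys (coeff f l) \<subseteq> S l}"

lemma fold_sumsI: "set_mset M \<subseteq> B \<Longrightarrow> sum_mset M \<in> fold_sums B (size M)"
  by (auto simp: fold_sums_def)

lemma fold_sumsE:
  assumes "a \<in> fold_sums B l"
  obtains M where "set_mset M \<subseteq> B" "size M = l" "a = sum_mset M"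
  using assms by (auto simp: fold_sums_def)

lemma zero_in_fold_sums: "0 \<in> fold_sums B 0"
  using fold_sumsI[of "{#}" B] by simp

lemma fold_sums_single: "b \<in> B \<Longrightarrow> b \<in> fold_sums B 1"
  using fold_sumsI[of "{#b#}" B] by simp

lemma fold_sums_add:
  assumes "a \<in> fold_sums B l" "b \<in> fold_sums B k"
  shows "a + b \<in> fold_sums B (l + k)"
proof -
  from assms obtain M N where "set_mset M \<subseteq> B" "size M = l" "a = sum_mset M"
    "set_mset N \<subseteq> B" "size N = k" "b = sum_mset N"
    by (metis fold_sumsE)
  then show ?thesis using fold_sumsI[of "M + N" B] by simp
qed

lemma zero_in_fold_sums_if_zero:
  assumes "0 \<in> B"
  shows "0 \<in> fold_sums B k"
proof (induction k)
  case 0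
  show ?case by (rule zero_in_fold_sums)
next
  case (Suc k)
  show ?case using fold_sums_add[OF Suc fold_sums_single[OF assms]] by simp
qed

lemma finite_fold_sums:
  assumes "finite B"
  shows "finite (fold_sums B l)"
proof -
  have "fold_sums B l \<subseteq> sum_list ` {xs. set xs \<subseteq> B \<and> length xs = l}"
  proof
    fix a assume "a \<in> fold_sums B l"
    then obtain M where M: "set_mset M \<subseteq> B" "size M = l" "a = sum_mset M" by (rule fold_sumsE)
    obtain xs where "mset xs = M" by (metis ex_mset)
    with M show "a \<in> sum_list ` {xs. set xs \<subseteq> B \<and> length xs = l}"
      by (auto simp: sum_mset_sum_list)
  qed
  then show ?thesis by (rule finite_subset) (simp add: finite_lists_length_eq assms)
qed

text \<open>In a well-order every tail of a sequence attains its minimum; positions of successive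
  tail minima form the subsequence.\<close>

lemma wellorder_incseq_subseq:
  fixes s :: "nat \<Rightarrow> 'a::wellorder"
  shows "\<exists>r. strict_mono r \<and> incseq (\<lambda>n. s (r n))"
proof -
  have least: "\<exists>y>x. \<forall>m\<ge>y. s y \<le> s m" for x
  proof -
    let ?T = "s ` {x<..}"
    have "(LEAST v. v \<in> ?T) \<in> ?T"
      by (rule LeastI_ex) (auto intro: exI[of _ "Suc x"])
    then obtain y where y: "y > x" "s y = (LEAST v. v \<in> ?T)" by auto
    have "s y \<le> s m" if "m \<ge> y" for m
      unfolding y(2) by (rule Least_le) (use y(1) that in auto)
    with y(1) show ?thesis by blast
  qed
  have "\<exists>r. \<forall>n. (\<forall>m\<ge>r n. s (r n) \<le> s m) \<and> r n < r (Suc n)"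
    by (intro dependent_nat_choice) (use least in \<open>auto simp: conj_commute\<close>)
  then obtain r where r: "\<And>n m. m \<ge> r n \<Longrightarrow> s (r n) \<le> s m" "\<And>n. r n < r (Suc n)"
    by blast
  then show ?thesis
    by (intro exI[of _ r]) (auto simp: strict_mono_Suc_iff incseq_Suc_iff less_imp_le)
qed

text \<open>Passing to a subsequence for each element of \<open>B\<close> in turn makes all
  multiplicities weakly increasing at once; the first two terms of the result are then
  comparable.\<close>

lemma dickson_multiset:
  fixes M :: "nat \<Rightarrow> 'a multiset"
  assumes "finite B" and M: "\<And>i. set_mset (M i) \<subseteq> B"
  obtains i j where "i < j" "M i \<subseteq># M j"
proof -
  have "\<exists>r. strict_mono r \<and> (\<forall>b\<in>B. incseq (\<lambda>n. count (M (r n)) b))"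
    using \<open>finite B\<close>
  proof induction
    case empty
    show ?case by (rule exI[of _ id]) (simp add: strict_mono_def)
  next
    case (insert b B)
    then obtain r where r: "strict_mono r" "\<And>c. c \<in> B \<Longrightarrow> incseq (\<lambda>n. count (M (r n)) c)"
      by blast
    obtain q where q: "strict_mono q" "incseq (\<lambda>n. count (M (r (q n))) b)"
      using wellorder_incseq_subseq[of "\<lambda>n. count (M (r n)) b"] by blast
    have "incseq (\<lambda>n. count (M (r (q n))) c)" if "c \<in> B" for c
      using r(2)[OF that] strict_mono_mono[OF q(1)] by (simp add: mono_def)
    with q r(1) show ?case
      by (intro exI[of _ "r \<circ> q"]) (auto simp: strict_mono_def)
  qed
  then obtain r where r: "strict_mono r" "\<And>b. b \<in> B \<Longrightarrow> incseq (\<lambda>n. count (M (r n)) b)"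
    by blast
  have "count (M (r 0)) b \<le> count (M (r 1)) b" for b
  proof (cases "b \<in> B")
    case True
    with r(2)[OF this] show ?thesis by (simp add: mono_def)
  next
    case False
    with M[of "r 0"] have "b \<notin># M (r 0)" by blast
    then show ?thesis by (simp add: not_in_iff)
  qed
  then have "M (r 0) \<subseteq># M (r 1)" by (rule mset_subset_eqI)
  moreover have "r 0 < r 1" using r(1) by (simp add: strict_mono_def)
  ultimately show ?thesis using that by blast
qed

text \<open>
  Dickson's lemma applied to multisets summing to the points of the ray replaces the usual
  argument that the cone over the generators is closed.
\<close>

lemma ray_in_saturated:
  fixes B :: "'e::ab_group_add set"
  assumes "finite B" "saturated (fold_sums B)"
    and ray: "\<And>i. w + (\<Sum>j<i. a) \<in> fold_sums B (l + i * k)"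
  shows "a \<in> fold_sums B k"
proof -
  have "\<forall>i. \<exists>M. set_mset M \<subseteq> B \<and> size M = l + i * k \<and> w + (\<Sum>j<i. a) = sum_mset M"
    using ray by (metis fold_sumsE)
  then obtain M where M: "\<And>i. set_mset (M i) \<subseteq> B" "\<And>i. size (M i) = l + i * k"
    "\<And>i. w + (\<Sum>j<i. a) = sum_mset (M i)"
    by metis
  obtain i j where ij: "i < j" "M i \<subseteq># M j"
    using dickson_multiset[OF assms(1) M(1)] .
  have "(\<Sum>n<j - i. a) + (\<Sum>n<i. a) = (\<Sum>n<j. a)"
    using sum.atLeastLessThan_concat[of 0 i j "\<lambda>_. a"] ij(1)
      sum.shift_bounds_nat_ivl[of "\<lambda>_. a" 0 i "j - i"]
    by (simp add: lessThan_atLeast0 add.commute)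
  moreover have "sum_mset (M j - M i) + sum_mset (M i) = sum_mset (M j)"
    using ij(2) by (metis subset_mset.diff_add sum_mset.union)
  \<comment> \<open>Subtracting the ray equation for \<open>i\<close> from the one for
    \<open>j\<close> eliminates the offset \<open>w\<close>.\<close>
  ultimately have "(\<Sum>n<j - i. a) = sum_mset (M j - M i)"
    using M(3)[of i] M(3)[of j] by (metis add.left_commute add_right_cancel)
  moreover have "size (M j - M i) = (j - i) * k"
    using ij by (simp add: size_Diff_submset M(2) diff_mult_distrib)
  moreover have "set_mset (M j - M i) \<subseteq> B"
    using M(1)[of j] by (meson in_diffD subset_iff)
  ultimately have "(\<Sum>n<j - i. a) \<in> fold_sums B ((j - i) * k)"
    using fold_sumsI by metis
  with assms(2) ij(1) show ?thesis
    unfolding saturated_def by (meson zero_less_diff)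
qed

section \<open>Leading terms of Laurent polynomials\<close>

lemma monomial_spanI: "(\<And>l. Poly_Mapping.keys (coeff f l) \<subseteq> S l) \<Longrightarrow> f \<in> monomial_span S"
  by (simp add: monomial_span_def)

lemma monomial_spanD: "f \<in> monomial_span S \<Longrightarrow> Poly_Mapping.keys (coeff f l) \<subseteq> S l"
  by (simp add: monomial_span_def)

lemma zero_in_monomial_span: "0 \<in> monomial_span S"
  by (simp add: monomial_span_def)

lemma monom_in_monomial_span: "a \<in> S l \<Longrightarrow> monom (Poly_Mapping.single a c) l \<in> monomial_span S"
  by (auto simp: monomial_span_def coeff_monom)

lemma monomial_span_add:
  assumes "f \<in> monomial_span S" "g \<in> monomial_span S"
  shows "f + g \<in> monomial_span S"
  using assms keys_add by (fastforce simp: monomial_span_def)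

lemma keys_uminus: "Poly_Mapping.keys (- f) = Poly_Mapping.keys (f :: 'a \<Rightarrow>\<^sub>0 'b::ab_group_add)"
  by (auto simp: in_keys_iff)

lemma monomial_span_uminus:
  "f \<in> monomial_span S \<Longrightarrow> - f \<in> monomial_span (S :: nat \<Rightarrow> 'e set)"
  for f :: "('e \<Rightarrow>\<^sub>0 'k::ab_group_add) poly"
  by (simp add: monomial_span_def keys_uminus)

lemma monomial_span_diff:
  "f \<in> monomial_span S \<Longrightarrow> g \<in> monomial_span S \<Longrightarrow> f - g \<in> monomial_span (S :: nat \<Rightarrow> 'e set)"
  for f :: "('e \<Rightarrow>\<^sub>0 'k::ab_group_add) poly"
  using monomial_span_add[of f S "- g"] monomial_span_uminus[of g S] by simp

lemma keys_sum_subset: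
  fixes b :: "'i \<Rightarrow> 'a \<Rightarrow>\<^sub>0 'b::comm_monoid_add"
  assumes "\<And>i. i \<in> I \<Longrightarrow> Poly_Mapping.keys (b i) \<subseteq> T"
  shows "Poly_Mapping.keys (sum b I) \<subseteq> T"
  using assms
proof (induction I rule: infinite_finite_induct)
  case (insert i I)
  then show ?case using keys_add[of "b i" "sum b I"] by fastforce
qed auto

lemma monomial_span_mult:
  fixes f g :: "('e::comm_monoid_add \<Rightarrow>\<^sub>0 'k::comm_semiring_0) poly"
  assumes S: "\<And>a b l k. a \<in> S l \<Longrightarrow> b \<in> S k \<Longrightarrow> a + b \<in> S (l + k)"
    and fg: "f \<in> monomial_span S" "g \<in> monomial_span S"
  shows "f * g \<in> monomial_span S"
proof (rule monomial_spanI)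
  fix l
  show "Poly_Mapping.keys (coeff (f * g) l) \<subseteq> S l"
    unfolding coeff_mult
  proof (rule keys_sum_subset)
    fix i assume "i \<in> {..l}"
    with S[of _ i _ "l - i"] keys_mult[of "coeff f i" "coeff g (l - i)"]
      monomial_spanD[OF fg(1), of i] monomial_spanD[OF fg(2), of "l - i"]
    show "Poly_Mapping.keys (coeff f i * coeff g (l - i)) \<subseteq> S l" by fastforce
  qed
qed

text \<open>The value at the zero polynomial carries no meaning.\<close>

definition lead_exp :: "('e::linorder \<Rightarrow>\<^sub>0 'k::zero) \<Rightarrow> 'e" where
  "lead_exp f = Max (Poly_Mapping.keys f)"

lemma lead_exp_in_keys: "f \<noteq> 0 \<Longrightarrow> lead_exp f \<in> Poly_Mapping.keys f"
  unfolding lead_exp_def by (rule Max_in) (auto simp: poly_mapping_eq_iff in_keys_iff fun_eq_iff)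

lemma lead_exp_ge: "a \<in> Poly_Mapping.keys f \<Longrightarrow> a \<le> lead_exp f"
  by (simp add: lead_exp_def)

text \<open>The order is total and translation invariant, so the two maximal exponents are the only
  pair of exponents with their sum, and the product of their coefficients is nonzero.\<close>

lemma lead_exp_mult:
  fixes f g :: "'e::linordered_ab_group_add \<Rightarrow>\<^sub>0 'k::semiring_no_zero_divisors"
  assumes "f \<noteq> 0" "g \<noteq> 0"
  shows "lead_exp (f * g) = lead_exp f + lead_exp g"
    and "Poly_Mapping.lookup (f * g) (lead_exp f + lead_exp g) =
      Poly_Mapping.lookup f (lead_exp f) * Poly_Mapping.lookup g (lead_exp g)"
proof -
  have le: "c \<le> lead_exp f + lead_exp g" if "c \<in> Poly_Mapping.keys (f * g)" for c
    using keys_mult[of f g] that lead_exp_ge[of _ f] lead_exp_ge[of _ g] by (blast intro: add_mono)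
  let ?c = "lead_exp f + lead_exp g"
  have *: "Poly_Mapping.lookup f a * (\<Sum>q. Poly_Mapping.lookup g q when ?c = a + q) =
      (Poly_Mapping.lookup f a * Poly_Mapping.lookup g (lead_exp g) when a = lead_exp f)" for a
  proof -
    have "(\<Sum>q. Poly_Mapping.lookup g q when ?c = a + q) =
        (\<Sum>q. Poly_Mapping.lookup g q when ?c - a = q)"
      by (rule Sum_any.cong) (auto simp: when_def algebra_simps)
    then have inner: "(\<Sum>q. Poly_Mapping.lookup g q when ?c = a + q) = Poly_Mapping.lookup g (?c - a)"
      by simp
    show ?thesis
    proof (cases "a \<in> Poly_Mapping.keys f \<and> ?c - a \<in> Poly_Mapping.keys g")
      case True
      then have "a \<le> lead_exp f" "?c - a \<le> lead_exp g" by (blast intro: lead_exp_ge)+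
      then have "a = lead_exp f"
        by (metis add.commute add_le_cancel_left antisym diff_le_eq)
      then show ?thesis by (simp add: inner)
    next
      case False
      then show ?thesis unfolding inner by (auto simp: when_def in_keys_iff)
    qed
  qed
  show lookup: "Poly_Mapping.lookup (f * g) ?c =
      Poly_Mapping.lookup f (lead_exp f) * Poly_Mapping.lookup g (lead_exp g)"
    unfolding lookup_mult * by simp
  have "Poly_Mapping.lookup (f * g) ?c \<noteq> 0"
    unfolding lookup using assms lead_exp_in_keys[of f] lead_exp_in_keys[of g]
    by (simp add: in_keys_iff)
  then show "lead_exp (f * g) = lead_exp f + lead_exp g"
    unfolding lead_exp_def[of "f * g"] using le by (intro Max_eqI) (auto simp: in_keys_iff)
qed

lemma lead_exp_power:
  fixes f :: "'e::linordered_ab_group_add \<Rightarrow>\<^sub>0 'k::idom"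
  assumes "f \<noteq> 0"
  shows "lead_exp (f ^ i) = (\<Sum>j<i. lead_exp f)"
proof (induction i)
  case 0
  show ?case by (simp add: lead_exp_def)
next
  case (Suc i)
  with assms show ?case by (simp add: lead_exp_mult add.commute)
qed

text \<open>Comparing leading terms in \<open>d * f ^ i = g ^ i * h\<close> puts the leading
  exponent of \<open>d\<close> plus \<open>i\<close> times that of f / g into the semigroup for
  every \<open>i\<close>; then \<open>ray_in_saturated\<close> applies.\<close>

lemma lead_quotient_in_saturated:
  fixes f g d :: "('e::linordered_ab_group_add \<Rightarrow>\<^sub>0 'k::idom) poly"
  assumes B: "finite B" "saturated (fold_sums B)"
    and nz: "f \<noteq> 0" "g \<noteq> 0" "d \<noteq> 0"
    and div: "\<And>i. \<exists>h\<in>monomial_span (fold_sums B). d * f ^ i = g ^ i * h"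
  shows "degree g \<le> degree f"
    and "lead_exp (lead_coeff f) - lead_exp (lead_coeff g) \<in> fold_sums B (degree f - degree g)"
proof -
  obtain h where h: "\<And>i. h i \<in> monomial_span (fold_sums B)" "\<And>i. d * f ^ i = g ^ i * h i"
    using div by metis
  have hnz: "h i \<noteq> 0" for i
    using h(2)[of i] nz by auto
  have deg: "degree d + i * degree f = i * degree g + degree (h i)" for i
    using arg_cong[OF h(2)[of i], of degree] nz hnz[of i]
    by (simp add: degree_mult_eq degree_power_eq)
  show le: "degree g \<le> degree f"
  proof (rule ccontr)
    assume "\<not> ?thesis"
    \<comment> \<open>For \<open>i = Suc (degree d)\<close> the degree deficit of f / g, at least 1
      per factor, exceeds what \<open>d\<close> can compensate.\<close>
    then have "Suc (degree d) * Suc (degree f) \<le> Suc (degree d) * degree g"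
      by (intro mult_le_mono2) simp
    with deg[of "Suc (degree d)"] show False by simp
  qed
  let ?a = "lead_exp (lead_coeff f) - lead_exp (lead_coeff g)"
  show "?a \<in> fold_sums B (degree f - degree g)"
  proof (rule ray_in_saturated[OF B])
    fix i
    have lc: "lead_coeff d * lead_coeff f ^ i = lead_coeff g ^ i * lead_coeff (h i)"
      using arg_cong[OF h(2)[of i], of lead_coeff] by (simp add: lead_coeff_mult lead_coeff_power)
    have "lead_exp (lead_coeff d) + (\<Sum>j<i. lead_exp (lead_coeff f)) =
        (\<Sum>j<i. lead_exp (lead_coeff g)) + lead_exp (lead_coeff (h i))"
      using arg_cong[OF lc, of lead_exp] nz hnz[of i]
      by (simp add: lead_exp_mult lead_exp_power)
    then have "lead_exp (lead_coeff d) + (\<Sum>j<i. ?a) = lead_exp (lead_coeff (h i))"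
      by (simp add: sum_subtractf algebra_simps)
    moreover have "degree d + i * (degree f - degree g) = degree (h i)"
      using deg[of i] mult_le_mono2[OF le, of i] by (simp add: diff_mult_distrib2)
    moreover have "lead_exp (lead_coeff (h i)) \<in> fold_sums B (degree (h i))"
      using lead_exp_in_keys[of "lead_coeff (h i)"] hnz[of i]
        monomial_spanD[OF h(1)[of i], of "degree (h i)"] by auto
    ultimately show "lead_exp (lead_coeff d) + (\<Sum>j<i. ?a) \<in>
        fold_sums B (degree d + i * (degree f - degree g))"
      by simp
  qed
qed

section \<open>Division by leading terms over a saturated semigroup\<close>

definition lex_less :: "nat \<times> 'e::linorder \<Rightarrow> nat \<times> 'e \<Rightarrow> bool" where
  "lex_less p q \<longleftrightarrow> fst p < fst q \<or> (fst p = fst q \<and> snd p < snd q)"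

text \<open>The monomial \<open>q\<close> is the quotient of the leading terms, so
  \<open>q * g\<close> and \<open>f\<close> share their leading term and it drops out of the
  difference.\<close>

lemma lead_term_cancel:
  fixes f g q r :: "('e::linordered_ab_group_add \<Rightarrow>\<^sub>0 'k::field) poly"
  assumes nz: "f \<noteq> 0" "g \<noteq> 0" and le: "degree g \<le> degree f"
  defines "q \<equiv> monom (Poly_Mapping.single (lead_exp (lead_coeff f) - lead_exp (lead_coeff g))
    (Poly_Mapping.lookup (lead_coeff f) (lead_exp (lead_coeff f)) /
      Poly_Mapping.lookup (lead_coeff g) (lead_exp (lead_coeff g)))) (degree f - degree g)"
    and "r \<equiv> f - q * g"
  assumes r: "r \<noteq> 0"
  shows "lex_less (degree r, lead_exp (lead_coeff r)) (degree f, lead_exp (lead_coeff f))"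
proof -
  let ?s = "Poly_Mapping.single (lead_exp (lead_coeff f) - lead_exp (lead_coeff g))
    (Poly_Mapping.lookup (lead_coeff f) (lead_exp (lead_coeff f)) /
      Poly_Mapping.lookup (lead_coeff g) (lead_exp (lead_coeff g)))"
  have lkf: "Poly_Mapping.lookup (lead_coeff f) (lead_exp (lead_coeff f)) \<noteq> 0"
    and lkg: "Poly_Mapping.lookup (lead_coeff g) (lead_exp (lead_coeff g)) \<noteq> 0"
    using lead_exp_in_keys[of "lead_coeff f"] lead_exp_in_keys[of "lead_coeff g"] nz
    by (auto simp: in_keys_iff)
  then have s: "?s \<noteq> 0" "lead_exp ?s = lead_exp (lead_coeff f) - lead_exp (lead_coeff g)"
    by (auto simp: lead_exp_def poly_mapping_eq_iff fun_eq_iff lookup_single)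
  have q: "q \<noteq> 0" "degree q = degree f - degree g" "lead_coeff q = ?s"
    using s(1) by (auto simp: q_def degree_monom_eq monom_eq_0_iff)
  have degqg: "degree (q * g) = degree f"
    using q nz le by (simp add: degree_mult_eq)
  have "degree r \<le> degree f"
    using degree_diff_le[of f "degree f" "q * g"] degqg by (simp add: r_def)
  \<comment> \<open>If the degree in \<open>s\<close> does not drop, the leading coefficients are
    subtracted and their common top monomial cancels.\<close>
  moreover have "lead_exp (lead_coeff r) < lead_exp (lead_coeff f)" if d: "degree r = degree f"
  proof -
    have lr: "lead_coeff r = lead_coeff f - ?s * lead_coeff g"
      using lead_coeff_mult[of q g] by (simp add: d[unfolded r_def] r_def degqg q(3))
    have lesg: "lead_exp (?s * lead_coeff g) = lead_exp (lead_coeff f)"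
      using s nz by (simp add: lead_exp_mult)
    have "Poly_Mapping.lookup (?s * lead_coeff g) (lead_exp (lead_coeff f)) =
        Poly_Mapping.lookup (lead_coeff f) (lead_exp (lead_coeff f))"
      using lead_exp_mult(2)[OF s(1), of "lead_coeff g"] nz lkg unfolding s(2) by simp
    then have "lead_exp (lead_coeff f) \<notin> Poly_Mapping.keys (lead_coeff r)"
      by (simp add: lr in_keys_iff lookup_minus)
    moreover have mem: "lead_exp (lead_coeff r) \<in> Poly_Mapping.keys (lead_coeff r)"
      using r by (intro lead_exp_in_keys) simp
    moreover have "Poly_Mapping.keys (lead_coeff r) \<subseteq>
        Poly_Mapping.keys (lead_coeff f) \<union> Poly_Mapping.keys (?s * lead_coeff g)"
      unfolding lr by (auto simp: in_keys_iff lookup_minus)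
    with mem have "lead_exp (lead_coeff r) \<le> lead_exp (lead_coeff f)"
      using lead_exp_ge[of _ "lead_coeff f"] lead_exp_ge[of _ "?s * lead_coeff g"] lesg by auto
    ultimately show ?thesis by (metis order_le_less)
  qed
  ultimately show ?thesis by (auto simp: lex_less_def)
qed

text \<open>In a domain, \<open>div\<close> says that \<open>d\<close> is a common denominator for
  all powers of f / g. Expanding the powers of f / g - q shows that the same \<open>d\<close> serves
  for them.\<close>

lemma almost_integral_reduce:
  fixes A :: "'a::comm_ring_1 set"
  assumes A: "\<And>x y. x \<in> A \<Longrightarrow> y \<in> A \<Longrightarrow> x - y \<in> A" "\<And>x y. x \<in> A \<Longrightarrow> y \<in> A \<Longrightarrow> x * y \<in> A"
    and q: "q \<in> A" and div: "\<And>i. \<exists>h\<in>A. d * f ^ i = g ^ i * h"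
  shows "\<exists>h\<in>A. d * (f - q * g) ^ i = g ^ i * h"
proof -
  \<comment> \<open>The extra factor \<open>f ^ j\<close> replaces the binomial expansion: splitting
    off one factor \<open>f - q * g\<close> either raises \<open>j\<close> by one or yields the
    factor \<open>q * g\<close>.\<close>
  have "\<exists>h\<in>A. d * f ^ j * (f - q * g) ^ i = g ^ (i + j) * h" for j
  proof (induction i arbitrary: j)
    case 0
    show ?case using div[of j] by simp
  next
    case (Suc i)
    obtain h where h: "h \<in> A" "d * f ^ Suc j * (f - q * g) ^ i = g ^ (i + Suc j) * h"
      using Suc[of "Suc j"] by blast
    obtain h' where h': "h' \<in> A" "d * f ^ j * (f - q * g) ^ i = g ^ (i + j) * h'"
      using Suc[of j] by blast
    have "d * f ^ j * (f - q * g) ^ Suc i =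
        d * f ^ Suc j * (f - q * g) ^ i - q * g * (d * f ^ j * (f - q * g) ^ i)"
      by (simp add: algebra_simps)
    also have "\<dots> = g ^ (Suc i + j) * (h - q * h')"
      unfolding h(2) h'(2) by (simp add: algebra_simps)
    finally show ?case using A h(1) h'(1) q by blast
  qed
  from this[of 0] show ?thesis by simp
qed

lemma lex_less_irrefl: "\<not> lex_less p p"
  by (simp add: lex_less_def)

lemma lex_less_trans: "lex_less p q \<Longrightarrow> lex_less q r \<Longrightarrow> lex_less p r"
  by (auto simp: lex_less_def)

text \<open>The remainder inherits the hypothesis \<open>div\<close>, so reduction can only stop at
  remainder 0. The order on exponents need not be well-founded, hence termination is by
  counting.\<close>

lemma saturated_division:
  fixes f g d :: "('e::linordered_ab_group_add \<Rightarrow>\<^sub>0 'k::field) poly"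
  assumes B: "finite B" "saturated (fold_sums B)"
    and nz: "g \<noteq> 0" "d \<noteq> 0"
    and div: "\<And>i. \<exists>h\<in>monomial_span (fold_sums B). d * f ^ i = g ^ i * h"
  shows "\<exists>q\<in>monomial_span (fold_sums B). f = q * g"
proof -
  let ?A = "monomial_span (fold_sums B) :: ('e \<Rightarrow>\<^sub>0 'k) poly set"
  define lt :: "('e \<Rightarrow>\<^sub>0 'k) poly \<Rightarrow> nat \<times> 'e" where "lt f = (degree f, lead_exp (lead_coeff f))" for f
  \<comment> \<open>A quotient term at \<open>p\<close> contributes to the product with
    \<open>g\<close> a leading term at \<open>sh p\<close>.\<close>
  define sh where "sh p = (fst p + fst (lt g), snd p + snd (lt g))" for p :: "nat \<times> 'e"
  \<comment> \<open>The exponents that can still occur in the quotient; their number decreases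
    with each reduction.\<close>
  define T where "T f = {p. snd p \<in> fold_sums B (fst p) \<and> (sh p = lt f \<or> lex_less (sh p) (lt f))}" for f
  have fin: "finite (T f)" for f
  proof (rule finite_subset)
    show "T f \<subseteq> (SIGMA l:{..degree f}. fold_sums B l)"
      by (auto simp: T_def sh_def lex_less_def lt_def)
  qed (simp add: finite_fold_sums B(1))
  show ?thesis
    using div
  proof (induction "card (T f)" arbitrary: f rule: less_induct)
    case less
    show ?case
    proof (cases "f = 0")
      case True
      then show ?thesis using zero_in_monomial_span by (intro bexI[of _ 0]) auto
    next
      case fnz: False
      let ?u = "(fst (lt f) - fst (lt g), snd (lt f) - snd (lt g))"
      note lq = lead_quotient_in_saturated[OF B fnz nz less.prems]
      define q where "q = monom (Poly_Mapping.single (lead_exp (lead_coeff f) - lead_exp (lead_coeff g))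
        (Poly_Mapping.lookup (lead_coeff f) (lead_exp (lead_coeff f)) /
          Poly_Mapping.lookup (lead_coeff g) (lead_exp (lead_coeff g)))) (degree f - degree g)"
      have q: "q \<in> ?A" unfolding q_def by (intro monom_in_monomial_span lq(2))
      define r where "r = f - q * g"
      have div_r: "\<exists>h\<in>?A. d * r ^ i = g ^ i * h" for i
        unfolding r_def
      proof (rule almost_integral_reduce[OF _ _ q less.prems])
        show "x * y \<in> ?A" if "x \<in> ?A" "y \<in> ?A" for x y
          by (rule monomial_span_mult[OF fold_sums_add that])
      qed (rule monomial_span_diff)
      have "\<exists>q'\<in>?A. r = q' * g"
      proof (cases "r = 0")
        case True
        then show ?thesis using zero_in_monomial_span by (intro bexI[of _ 0]) auto
      next
        case rnz: False
        have lt: "lex_less (lt r) (lt f)"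
          using lead_term_cancel[OF fnz nz(1) lq(1)] rnz unfolding q_def r_def lt_def by blast
        have "sh ?u = lt f" using lq(1) by (simp add: sh_def lt_def)
        moreover have "snd ?u \<in> fold_sums B (fst ?u)" using lq(2) by (simp add: lt_def)
        \<comment> \<open>The term just divided out is no longer available: its shift is the leading
          term of \<open>f\<close>, which lies strictly above that of \<open>r\<close>.\<close>
        ultimately have "?u \<in> T f" "?u \<notin> T r"
          using lt lex_less_trans[of "lt f" "lt r" "lt f"] lex_less_irrefl[of "lt f"]
          by (auto simp: T_def)
        moreover have "T r \<subseteq> T f"
          by (auto simp: T_def lt dest: lex_less_trans[OF _ lt])
        ultimately have "T r \<subset> T f" by blast
        then show ?thesis by (intro less.hyps div_r psubset_card_mono fin)
      qed
      then obtain q' where "q' \<in> ?A" "r = q' * g" by blast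
      with q show ?thesis
        by (intro bexI[of _ "q + q'"]) (auto simp: r_def algebra_simps intro: monomial_span_add)
    qed
  qed
qed

section \<open>Integral elements\<close>

lemma embed_fract_add: "embed_fract (a + b) = embed_fract a + embed_fract b"
  and embed_fract_mult: "embed_fract (a * b) = embed_fract a * embed_fract b"
  and embed_fract_uminus: "embed_fract (- a) = - embed_fract a"
  and embed_fract_0: "embed_fract 0 = 0"
  and embed_fract_1: "embed_fract 1 = 1"
  by (simp_all add: embed_fract_def Zero_fract_def One_fract_def)

lemma embed_fract_power: "embed_fract (a ^ n) = embed_fract a ^ n"
  by (induction n) (simp_all add: embed_fract_1 embed_fract_mult)

lemma embed_fract_sum: "embed_fract (sum f I) = (\<Sum>i\<in>I. embed_fract (f i))"
  by (induction I rule: infinite_finite_induct) (simp_all add: embed_fract_0 embed_fract_add)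

lemma embed_fract_inject: "embed_fract a = embed_fract b \<longleftrightarrow> a = b"
  by (simp add: embed_fract_def eq_fract)

text \<open>
  Almost integrality is what the division uses: unlike an integral equation, in which leading
  terms may cancel, it can be compared on leading terms.
\<close>

lemma integral_imp_almost_integral:
  fixes A :: "'a::idom set"
  assumes A: "0 \<in> A" "1 \<in> A" "\<And>x. x \<in> A \<Longrightarrow> - x \<in> A" "\<And>x y. x \<in> A \<Longrightarrow> y \<in> A \<Longrightarrow> x + y \<in> A"
    "\<And>x y. x \<in> A \<Longrightarrow> y \<in> A \<Longrightarrow> x * y \<in> A"
    and fg: "f \<in> A" "g \<in> A" "g \<noteq> 0"
    and int: "integral_over (embed_fract ` A) (Fraction_Field.Fract f g)"
  shows "\<exists>m. \<forall>i. \<exists>h\<in>A. g ^ m * f ^ i = g ^ i * h"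
proof -
  let ?x = "Fraction_Field.Fract f g"
  have pow: "a ^ n \<in> A" if "a \<in> A" for a n
    by (induction n) (simp_all add: A that)
  have sum: "sum F I \<in> A" if "\<And>i. i \<in> I \<Longrightarrow> F i \<in> A" for F and I :: "nat set"
    using that by (induction I rule: infinite_finite_induct) (simp_all add: A)
  have gx: "embed_fract g * ?x = embed_fract f"
    using fg by (simp add: embed_fract_def eq_fract)
  obtain p where p: "lead_coeff p = 1" "\<And>i. coeff p i \<in> embed_fract ` A" "poly p ?x = 0"
    using int by (auto simp: integral_over_def)
  define m where "m = degree p"
  obtain c where c: "\<And>i. c i \<in> A" "\<And>i. coeff p i = embed_fract (c i)"
    using choice[of "\<lambda>i c. c \<in> A \<and> coeff p i = embed_fract c"] p(2) by blast
  have "(\<Sum>i<m. embed_fract (c i) * ?x ^ i) + ?x ^ m = 0"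
    using p(1,3) by (simp add: poly_altdef m_def c(2) lessThan_Suc_atMost[symmetric])
  \<comment> \<open>The monic equation is solved for its top power, which lets every power from the
    m-th on be lowered.\<close>
  then have xm: "?x ^ m = (\<Sum>i<m. embed_fract (- c i) * ?x ^ i)"
    by (simp add: embed_fract_uminus sum_negf add_eq_0_iff2)
  \<comment> \<open>Below \<open>m\<close> the factor \<open>g ^ m\<close> clears the denominator
    directly; from \<open>m\<close> on, \<open>xm\<close> rewrites the power through the smaller
    exponents \<open>j + (i - m)\<close>.\<close>
  have claim: "\<exists>h\<in>A. embed_fract (g ^ m) * ?x ^ i = embed_fract h" for i
  proof (induction i rule: less_induct)
    case (less i)
    show ?case
    proof (cases "i < m")
      case True
      have "g ^ m = g ^ (m - i) * g ^ i"
        using True by (simp flip: power_add)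
      then have "embed_fract (g ^ m) * ?x ^ i = embed_fract (g ^ (m - i)) * (embed_fract g ^ i * ?x ^ i)"
        by (simp only: embed_fract_mult embed_fract_power mult.assoc)
      also have "\<dots> = embed_fract (g ^ (m - i) * f ^ i)"
        by (simp only: gx embed_fract_mult embed_fract_power flip: power_mult_distrib)
      finally show ?thesis
        using A(5)[OF pow[OF fg(2)] pow[OF fg(1)]] by blast
    next
      case False
      have "\<forall>j\<in>{..<m}. \<exists>h\<in>A. embed_fract (g ^ m) * ?x ^ (j + (i - m)) = embed_fract h"
        using False by (intro ballI less) auto
      then obtain h where h: "\<And>j. j < m \<Longrightarrow> h j \<in> A"
        "\<And>j. j < m \<Longrightarrow> embed_fract (g ^ m) * ?x ^ (j + (i - m)) = embed_fract (h j)"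
        using bchoice[of "{..<m}" "\<lambda>j h. h \<in> A \<and>
          embed_fract (g ^ m) * ?x ^ (j + (i - m)) = embed_fract h"] by auto
      have "embed_fract (g ^ m) * ?x ^ i = embed_fract (g ^ m) * (?x ^ m * ?x ^ (i - m))"
        using False by (simp flip: power_add)
      also have "\<dots> = (\<Sum>j<m. embed_fract (- c j) * (embed_fract (g ^ m) * ?x ^ (j + (i - m))))"
        unfolding xm by (simp add: sum_distrib_left sum_distrib_right power_add mult_ac)
      also have "\<dots> = embed_fract (\<Sum>j<m. - c j * h j)"
        by (simp add: h(2) embed_fract_sum embed_fract_mult del: mult_minus_left)
      finally have "embed_fract (g ^ m) * ?x ^ i = embed_fract (\<Sum>j<m. - c j * h j)" .
      moreover have "(\<Sum>j<m. - c j * h j) \<in> A"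
        by (rule sum) (simp only: lessThan_iff A(3)[OF c(1)] A(5) h(1))
      ultimately show ?thesis by blast
    qed
  qed
  \<comment> \<open>Multiplying the claim by \<open>g ^ i\<close> turns it into an identity free of
    fractions.\<close>
  have "\<exists>h\<in>A. g ^ m * f ^ i = g ^ i * h" for i
  proof -
    obtain h where h: "h \<in> A" "embed_fract (g ^ m) * ?x ^ i = embed_fract h"
      using claim by blast
    have "embed_fract (g ^ m * f ^ i) = embed_fract (g ^ i) * (embed_fract (g ^ m) * ?x ^ i)"
      by (simp only: embed_fract_mult embed_fract_power power_mult_distrib mult_ac flip: gx)
    also have "\<dots> = embed_fract (g ^ i * h)"
      by (simp add: h(2) embed_fract_mult)
    finally show ?thesis using h(1) by (auto simp: embed_fract_inject)
  qed
  then show ?thesis by blast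
qed

section \<open>Normality and saturation\<close>

lemma normal_domain_if_saturated:
  fixes B :: "'e::linordered_ab_group_add set"
  assumes B: "finite B" "saturated (fold_sums B)"
  shows "normal_domain (monomial_span (fold_sums B) :: ('e \<Rightarrow>\<^sub>0 'k::field) poly set)"
    (is "normal_domain ?A")
  unfolding normal_domain_def
proof (intro ballI impI)
  fix x assume x: "x \<in> fractions_of ?A" "integral_over (embed_fract ` ?A) x"
  then obtain f g where fg: "f \<in> ?A" "g \<in> ?A" "g \<noteq> 0" "x = Fraction_Field.Fract f g"
    by (auto simp: fractions_of_def)
  have one: "1 \<in> ?A"
    using monom_in_monomial_span[of 0 "fold_sums B" 0 "1::'k"] zero_in_fold_sums[of B]
    by (simp add: monom_0 one_pCons)
  obtain m where "\<And>i. \<exists>h\<in>?A. g ^ m * f ^ i = g ^ i * h"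
    using integral_imp_almost_integral[of ?A f g] x(2)[unfolded fg(4)] fg(1-3) one
      zero_in_monomial_span monomial_span_uminus monomial_span_add
      monomial_span_mult[of "fold_sums B", OF fold_sums_add] by blast
  \<comment> \<open>The division is applied with \<open>d = g ^ m\<close>; its exact quotient is the
    fraction itself.\<close>
  then obtain q where "q \<in> ?A" "f = q * g"
    using saturated_division[OF B fg(3), of "g ^ m"] fg(3) by auto
  then show "x \<in> embed_fract ` ?A"
    by (intro image_eqI[of _ _ q]) (simp_all add: fg(3,4) embed_fract_def eq_fract)
qed

text \<open>The monomial with exponent (a, k) is a root of the monic polynomial X^m - c, where c is
  its m-th power and lies in the ring. The assumption \<open>full\<close> makes it a fraction of
  ring elements, so normality puts it in the ring.\<close>

lemma saturated_if_normal_domain: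
  fixes B :: "'e::linordered_ab_group_add set"
  assumes normal: "normal_domain (monomial_span (fold_sums B) :: ('e \<Rightarrow>\<^sub>0 'k::field) poly set)"
      (is "normal_domain ?A")
    and zero: "0 \<in> B"
    and full: "\<And>a. \<exists>c N. c \<in> fold_sums B N \<and> a + c \<in> fold_sums B N"
  shows "saturated (fold_sums B)"
  unfolding saturated_def
proof (intro allI impI)
  fix m k and a :: 'e
  assume m: "0 < m" and ma: "(\<Sum>j<m. a) \<in> fold_sums B (m * k)"
  let ?t = "\<lambda>a l. monom (Poly_Mapping.single a (1::'k)) l"
  have mem: "?t a l \<in> ?A \<longleftrightarrow> a \<in> fold_sums B l" for a l
    by (auto simp: monomial_span_def coeff_monom)
  have mult: "?t a l * ?t b n = ?t (a + b) (l + n)" for a b l n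
    by (simp add: mult_monom mult_single)
  have pow: "?t a l ^ n = ?t (\<Sum>j<n. a) (n * l)" for a l n
    by (induction n) (simp_all add: mult monom_0 one_pCons add.commute)
  obtain c N where c: "c \<in> fold_sums B N" "a + c \<in> fold_sums B N"
    using full by blast
  \<comment> \<open>Adding the generator 0 \<open>k\<close> times raises the degree by
    \<open>k\<close> and leaves the exponent alone, so the quotient by the monomial of
    \<open>c\<close> has degree exactly \<open>k\<close>.\<close>
  have "a + c + 0 \<in> fold_sums B (N + k)"
    by (intro fold_sums_add c zero_in_fold_sums_if_zero zero)
  then have num: "?t (a + c) (N + k) \<in> ?A" and den: "?t c N \<in> ?A"
    using c(1) by (simp_all add: mem)
  have nz: "?t c N \<noteq> 0"
    by (simp add: monom_eq_0_iff poly_mapping_eq_iff fun_eq_iff lookup_single)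
  then have "embed_fract (?t a k) = Fraction_Field.Fract (?t (a + c) (N + k)) (?t c N)"
    by (simp add: embed_fract_def eq_fract mult add.commute)
  with num den nz have frac: "embed_fract (?t a k) \<in> fractions_of ?A"
    unfolding fractions_of_def by blast
  let ?p = "monom 1 m - [:embed_fract (?t a k ^ m):]"
  have "degree ?p = m"
    unfolding diff_conv_add_uminus
    by (subst degree_add_eq_left) (use m in \<open>simp_all add: degree_monom_eq\<close>)
  then have "lead_coeff ?p = 1" using m by (cases m) auto
  moreover have "coeff ?p i \<in> embed_fract ` ?A" for i
  proof -
    have "- (?t a k ^ m) \<in> ?A" "0 \<in> ?A" "1 \<in> ?A"
      using ma mem[of 0 0] zero_in_fold_sums[of B]
      by (auto simp: pow mem monom_0 one_pCons intro: monomial_span_uminus zero_in_monomial_span)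
    moreover have "coeff ?p i = embed_fract (if i = m then 1 else if i = 0 then - (?t a k ^ m) else 0)"
      using m by (cases i) (auto simp: coeff_monom embed_fract_0 embed_fract_1 embed_fract_uminus)
    ultimately show ?thesis by auto
  qed
  moreover have "poly ?p (embed_fract (?t a k)) = 0"
    by (simp add: poly_monom embed_fract_power)
  ultimately have "integral_over (embed_fract ` ?A) (embed_fract (?t a k))"
    unfolding integral_over_def by blast
  with normal frac have "embed_fract (?t a k) \<in> embed_fract ` ?A"
    unfolding normal_domain_def by blast
  then show "a \<in> fold_sums B k"
    by (auto simp: embed_fract_inject mem)
qed

text \<open>Each generator has degree 1 in \<open>s\<close>, so a product of \<open>l\<close>
  generators is a monomial of degree \<open>l\<close> whose exponent is a sum of \<open>l\<close>
  elements of \<open>B\<close>; scalars and sums give the rest.\<close>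

lemma monomial_span_fold_sums_eq_hull:
  "monomial_span (fold_sums B) =
    (k_subalgebra hull (t_pow_s ` B) :: ('n::{finite,linorder}, 'k::field) laurent poly set)"
    (is "?A = ?H")
proof
  have one: "range const \<subseteq> ?A"
    using zero_in_fold_sums[of B] by (auto simp: const_def simp flip: monom_0 intro: monom_in_monomial_span)
  then have "k_subalgebra ?A"
    by (auto simp: k_subalgebra_def intro: monomial_span_add monomial_span_mult[of "fold_sums B", OF fold_sums_add])
  moreover have "t_pow_s ` B \<subseteq> ?A"
    using fold_sums_single by (fastforce simp: t_pow_s_def intro: monom_in_monomial_span)
  ultimately show "?H \<subseteq> ?A" by (intro hull_minimal)
  have gen: "t_pow_s b \<in> ?H" if "b \<in> B" for b
    using hull_subset that by fastforce
  have sub: "k_subalgebra ?H"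
    by (rule hull_in) (auto simp: k_subalgebra_def)
  then have c: "const c \<in> ?H" and add: "f \<in> ?H \<Longrightarrow> g \<in> ?H \<Longrightarrow> f + g \<in> ?H"
    and mult: "f \<in> ?H \<Longrightarrow> g \<in> ?H \<Longrightarrow> f * g \<in> ?H" for c f g
    by (auto simp: k_subalgebra_def)
  have "const 0 \<in> ?H" by (rule c)
  then have zero: "0 \<in> ?H" by (simp add: const_def)
  have sum: "sum F I \<in> ?H" if "\<And>i. i \<in> I \<Longrightarrow> F i \<in> ?H" for F and I :: "'i set"
    using that by (induction I rule: infinite_finite_induct) (simp_all add: zero add)
  have one: "monom (Poly_Mapping.single (sum_mset M) 1) (size M) \<in> ?H" if "set_mset M \<subseteq> B" for M
    using that
  proof (induction M)
    case empty
    have "const 1 \<in> ?H" by (rule c)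
    then show ?case by (simp add: const_def monom_0)
  next
    case (add b M)
    then have "t_pow_s b * monom (Poly_Mapping.single (sum_mset M) 1) (size M) \<in> ?H"
      by (intro mult gen) auto
    then show ?case by (simp add: t_pow_s_def mult_monom mult_single)
  qed
  have scaled: "monom (Poly_Mapping.single a v) l \<in> ?H" if a: "a \<in> fold_sums B l" for a v l
  proof -
    have "const v * monom (Poly_Mapping.single a 1) l \<in> ?H"
      using a one by (intro mult c) (auto elim!: fold_sumsE)
    then show ?thesis by (simp add: const_def smult_monom mult_single)
  qed
  show "?A \<subseteq> ?H"
  proof
    fix f :: "('n, 'k) laurent poly" assume f: "f \<in> ?A"
    have expand: "p = (\<Sum>a\<in>Poly_Mapping.keys p. Poly_Mapping.single a (Poly_Mapping.lookup p a))"
      for p :: "('n, 'k) laurent"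
      by (rule poly_mapping_eqI) (auto simp: lookup_sum lookup_single when_def in_keys_iff)
    have "monom (coeff f l) l \<in> ?H" for l
    proof -
      have "monom (coeff f l) l = (\<Sum>a\<in>Poly_Mapping.keys (coeff f l).
          monom (Poly_Mapping.single a (Poly_Mapping.lookup (coeff f l) a)) l)"
        by (subst expand) (simp add: monom_sum)
      also have "\<dots> \<in> ?H"
        using monomial_spanD[OF f] by (intro sum scaled) blast
      finally show ?thesis .
    qed
    then have "(\<Sum>l\<le>degree f. monom (coeff f l) l) \<in> ?H" by (intro sum)
    then show "f \<in> ?H" by (simp add: poly_as_sum_of_monoms)
  qed
qed

text \<open>Every exponent vector arises from unit vectors by differences, and the property survives
  differences. It makes each monomial free of \<open>s\<close> a quotient of two monomials of equal
  degree.\<close>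

lemma fold_sums_unit_vectors_full:
  fixes a :: "'n \<Rightarrow>\<^sub>0 int"
  assumes "0 \<in> B" and unit: "\<And>i. frag_of i \<in> B"
  shows "\<exists>c N. c \<in> fold_sums B N \<and> a + c \<in> fold_sums B N"
proof -
  have "Poly_Mapping.keys a \<subseteq> UNIV" by simp
  then show ?thesis
  proof (induction rule: frag_induction)
    case zero
    show ?case using zero_in_fold_sums by auto
  next
    case (one i)
    have "0 \<in> fold_sums B 1" "frag_of i + 0 \<in> fold_sums B 1"
      using assms fold_sums_single by auto
    then show ?case by blast
  next
    case (diff a b)
    then obtain c N d M where "c \<in> fold_sums B N" "a + c \<in> fold_sums B N"
      "d \<in> fold_sums B M" "b + d \<in> fold_sums B M" by blast
    \<comment> \<open>For \<open>a - b\<close> the numerator of \<open>b\<close> joins the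
      denominator, as in dividing two fractions.\<close>
    then have "c + (b + d) \<in> fold_sums B (N + M)" "(a + c) + d \<in> fold_sums B (N + M)"
      by (auto intro: fold_sums_add)
    moreover have "a - b + (c + (b + d)) = (a + c) + d" by simp
    ultimately show ?case by metis
  qed
qed

text \<open>The right-hand side does not mention the field: normality becomes a question about
  lattice points alone.\<close>

lemma normal_toric_ring_iff_saturated:
  fixes Q :: "(real ^ 'n::{finite,linorder}) set"
  assumes "finite (lattice_points Q)" "0 \<in> lattice_points Q" "\<And>i. frag_of i \<in> lattice_points Q"
  shows "normal_domain (toric_ring Q :: ('n, 'k::field) laurent poly set) \<longleftrightarrow>
    saturated (fold_sums (lattice_points Q))"
  unfolding toric_ring_def monomial_span_fold_sums_eq_hull[symmetric]
  using normal_domain_if_saturated saturated_if_normal_domain fold_sums_unit_vectors_full assms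
  by metis

section \<open>Anti-blocking polytopes and sign reflections\<close>

definition abs_exp :: "('n::finite \<Rightarrow>\<^sub>0 int) \<Rightarrow> ('n \<Rightarrow>\<^sub>0 int)" where
  "abs_exp b = Abs_poly_mapping (\<lambda>i. \<bar>Poly_Mapping.lookup b i\<bar>)"

lemma lookup_abs_exp [simp]: "Poly_Mapping.lookup (abs_exp b) i = \<bar>Poly_Mapping.lookup b i\<bar>"
  by (simp add: abs_exp_def)

lemma abs_exp_eq: "(\<And>i. 0 \<le> Poly_Mapping.lookup b i) \<Longrightarrow> abs_exp b = b"
  by (rule poly_mapping_eqI) simp

text \<open>Discrete counterpart of the anti-blocking condition.\<close>

definition down_closed :: "('n \<Rightarrow>\<^sub>0 int) set \<Rightarrow> bool" where
  "down_closed L \<longleftrightarrow> (\<forall>b\<in>L. \<forall>i. 0 \<le> Poly_Mapping.lookup b i) \<and>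
    (\<forall>b\<in>L. \<forall>c. (\<forall>i. 0 \<le> Poly_Mapping.lookup c i \<and> Poly_Mapping.lookup c i \<le> Poly_Mapping.lookup b i)
      \<longrightarrow> c \<in> L)"

lemma down_closed_nonneg:
  assumes "down_closed L" "b \<in> L"
  shows "0 \<le> Poly_Mapping.lookup b i"
  using assms(1)[unfolded down_closed_def, THEN conjunct1, THEN bspec, OF assms(2), THEN spec] .

lemma down_closedD:
  assumes "down_closed L" "b \<in> L"
    and "\<And>i. 0 \<le> Poly_Mapping.lookup c i" "\<And>i. Poly_Mapping.lookup c i \<le> Poly_Mapping.lookup b i"
  shows "c \<in> L"
  using assms(1)[unfolded down_closed_def, THEN conjunct2, THEN bspec, OF assms(2), THEN spec,
      THEN mp] assms(3,4) by blast

text \<open>This is the Riesz decomposition property of integer vectors: a nonnegative vector below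
  a sum splits into nonnegative parts below the summands.\<close>

lemma down_closed_fold_sums:
  fixes L :: "('n::finite \<Rightarrow>\<^sub>0 int) set"
  assumes L: "down_closed L"
  shows "down_closed (fold_sums L l)"
proof -
  have nonneg: "0 \<le> Poly_Mapping.lookup (sum_mset M) i" if "set_mset M \<subseteq> L" for M i
    using that
  proof (induction M)
    case (add b M)
    with down_closed_nonneg[OF L, of b i] show ?case by (simp add: lookup_add)
  qed simp
  have down: "c \<in> fold_sums L (size M)"
    if "set_mset M \<subseteq> L" "\<And>i. 0 \<le> Poly_Mapping.lookup c i"
      "\<And>i. Poly_Mapping.lookup c i \<le> Poly_Mapping.lookup (sum_mset M) i" for M c
    using that
  proof (induction M arbitrary: c)
    case empty
    then have "c = 0" by (intro poly_mapping_eqI antisym) simp_all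
    then show ?case by (simp add: zero_in_fold_sums)
  next
    case (add b M)
    have b: "b \<in> L" and M: "set_mset M \<subseteq> L" using add.prems(1) by simp_all
    \<comment> \<open>Greedy splitting: \<open>c1\<close> takes as much of \<open>c\<close> as fits
      below the sum of \<open>M\<close>, and the excess fits below \<open>b\<close>.\<close>
    define c1 where
      "c1 = Abs_poly_mapping (\<lambda>i. min (Poly_Mapping.lookup c i) (Poly_Mapping.lookup (sum_mset M) i))"
    have c1: "Poly_Mapping.lookup c1 i =
        min (Poly_Mapping.lookup c i) (Poly_Mapping.lookup (sum_mset M) i)" for i
      by (simp add: c1_def)
    have "c1 \<in> fold_sums L (size M)"
      by (rule add.IH[OF M]) (simp_all add: c1 add.prems(2) nonneg[OF M])
    moreover have "c - c1 \<in> L"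
    proof (rule down_closedD[OF L b])
      fix i
      show "0 \<le> Poly_Mapping.lookup (c - c1) i" by (simp add: lookup_minus c1)
      show "Poly_Mapping.lookup (c - c1) i \<le> Poly_Mapping.lookup b i"
        using add.prems(3)[of i] down_closed_nonneg[OF L b, of i]
        by (simp add: lookup_minus c1 lookup_add min_def)
    qed
    ultimately have "(c - c1) + c1 \<in> fold_sums L (1 + size M)"
      by (intro fold_sums_add fold_sums_single)
    then show ?case by simp
  qed
  show ?thesis
    unfolding down_closed_def
  proof (intro conjI ballI allI impI)
    fix b i assume "b \<in> fold_sums L l"
    then obtain M where "set_mset M \<subseteq> L" "b = sum_mset M" by (rule fold_sumsE)
    then show "0 \<le> Poly_Mapping.lookup b i" using nonneg by blast
  next
    fix b c
    assume b: "b \<in> fold_sums L l"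
      and c: "\<forall>i. 0 \<le> Poly_Mapping.lookup c i \<and> Poly_Mapping.lookup c i \<le> Poly_Mapping.lookup b i"
    obtain M where "set_mset M \<subseteq> L" "size M = l" "b = sum_mset M"
      using b by (rule fold_sumsE)
    then show "c \<in> fold_sums L l" using down[of M c] c by blast
  qed
qed

text \<open>From left to right, the triangle inequality bounds the absolute values of a sum by a sum
  in \<open>L\<close>, and downward closure applies. Conversely, a decomposition of the absolute
  values is given the signs of \<open>b\<close>.\<close>

lemma abs_exp_vimage_fold_sums:
  fixes L :: "('n::finite \<Rightarrow>\<^sub>0 int) set"
  assumes L: "down_closed L"
  shows "fold_sums (abs_exp -` L) l = abs_exp -` fold_sums L l"
proof (intro equalityI subsetI)
  fix b assume "b \<in> fold_sums (abs_exp -` L) l"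
  then obtain M where M: "set_mset M \<subseteq> abs_exp -` L" "size M = l" "b = sum_mset M"
    by (rule fold_sumsE)
  from M(1) have "abs_exp (sum_mset M) \<in> fold_sums L (size M)"
  proof (induction M)
    case empty
    show ?case by (simp add: abs_exp_eq zero_in_fold_sums)
  next
    case (add b M)
    then have "abs_exp b + abs_exp (sum_mset M) \<in> fold_sums L (1 + size M)"
      by (intro fold_sums_add fold_sums_single) auto
    then have "abs_exp (b + sum_mset M) \<in> fold_sums L (1 + size M)"
      by (rule down_closedD[OF down_closed_fold_sums[OF L]]) (simp_all add: lookup_add abs_triangle_ineq)
    then show ?case by simp
  qed
  with M show "b \<in> abs_exp -` fold_sums L l" by simp
next
  fix b assume "b \<in> abs_exp -` fold_sums L l"
  then have "abs_exp b \<in> fold_sums L l" by simp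
  then obtain M where M: "set_mset M \<subseteq> L" "size M = l" "abs_exp b = sum_mset M"
    by (rule fold_sumsE)
  \<comment> \<open>An additive sign change with the sign pattern of \<open>b\<close>. It takes the
    absolute values of \<open>b\<close> back to \<open>b\<close>, and \<open>abs_exp\<close> undoes
    it on \<open>L\<close> because \<open>L\<close> is nonnegative.\<close>
  define flip where "flip c = Abs_poly_mapping
    (\<lambda>i. if Poly_Mapping.lookup b i < 0 then - Poly_Mapping.lookup c i else Poly_Mapping.lookup c i)"
    for c :: "'n \<Rightarrow>\<^sub>0 int"
  have flip: "Poly_Mapping.lookup (flip c) i =
      (if Poly_Mapping.lookup b i < 0 then - Poly_Mapping.lookup c i else Poly_Mapping.lookup c i)" for c i
    by (simp add: flip_def)
  have "flip (sum_mset M) = sum_mset (image_mset flip M)"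
  proof (induction M)
    case empty
    show ?case by (rule poly_mapping_eqI) (simp add: flip)
  next
    case (add c M)
    have "flip (c + sum_mset M) = flip c + flip (sum_mset M)"
      by (rule poly_mapping_eqI) (simp add: flip lookup_add)
    with add show ?case by simp
  qed
  moreover have "flip (sum_mset M) = b"
    unfolding M(3)[symmetric] by (rule poly_mapping_eqI) (simp add: flip)
  moreover have "abs_exp (flip c) = c" if "c \<in> L" for c
    using down_closed_nonneg[OF L that] by (intro poly_mapping_eqI) (simp add: flip)
  then have "set_mset (image_mset flip M) \<subseteq> abs_exp -` L"
    using M(1) by auto
  ultimately show "b \<in> fold_sums (abs_exp -` L) l"
    using fold_sumsI[of "image_mset flip M" "abs_exp -` L"] M(2) by simp
qed

text \<open>Absolute values commute with positive multiples, so saturation passes to the preimage;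
  in the other direction, a vector with a nonnegative positive multiple equals its own absolute
  value.\<close>

lemma saturated_abs_exp_vimage:
  fixes L :: "('n::finite \<Rightarrow>\<^sub>0 int) set"
  assumes L: "down_closed L"
  shows "saturated (fold_sums (abs_exp -` L)) \<longleftrightarrow> saturated (fold_sums L)"
proof -
  have abs_sum: "abs_exp (\<Sum>j<m. a) = (\<Sum>j<m. abs_exp a)" for m :: nat and a :: "'n \<Rightarrow>\<^sub>0 int"
    by (rule poly_mapping_eqI) (simp add: lookup_sum abs_mult)
  show ?thesis
  proof
    assume sat: "saturated (fold_sums (abs_exp -` L))"
    show "saturated (fold_sums L)"
      unfolding saturated_def
    proof (intro allI impI)
      fix m k and a :: "'n \<Rightarrow>\<^sub>0 int"
      assume m: "0 < m" and ma: "(\<Sum>j<m. a) \<in> fold_sums L (m * k)"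
      have nn: "0 \<le> Poly_Mapping.lookup (\<Sum>j<m. a) i" for i
        by (rule down_closed_nonneg[OF down_closed_fold_sums[OF L] ma])
      then have "abs_exp (\<Sum>j<m. a) \<in> fold_sums L (m * k)"
        using ma by (simp add: abs_exp_eq)
      then have "abs_exp a \<in> fold_sums L k"
        using sat m abs_exp_vimage_fold_sums[OF L] unfolding saturated_def by (metis vimage_eq)
      moreover have "0 \<le> Poly_Mapping.lookup a i" for i
        using nn[of i] m by (simp add: lookup_sum zero_le_mult_iff)
      ultimately show "a \<in> fold_sums L k" by (simp add: abs_exp_eq)
    qed
  next
    assume "saturated (fold_sums L)"
    then show "saturated (fold_sums (abs_exp -` L))"
      unfolding saturated_def abs_exp_vimage_fold_sums[OF L] vimage_eq abs_sum by simp
  qed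
qed

section \<open>Lattice points of the polytopes\<close>

lemma lattice_points_sign_reflections:
  fixes P :: "(real ^ 'n::{finite,linorder}) set"
  assumes nonneg: "\<And>x i. x \<in> P \<Longrightarrow> 0 \<le> x $ i"
  shows "lattice_points (sign_reflections P) = abs_exp -` lattice_points P"
proof (intro equalityI subsetI)
  fix b assume "b \<in> lattice_points (sign_reflections P)"
  then obtain e x where e: "\<And>i. e $ i \<in> {-1, 1}" and x: "x \<in> P"
    and b: "(\<chi> i. real_of_int (Poly_Mapping.lookup b i)) = (\<chi> i. e $ i * x $ i)"
    by (auto simp: lattice_points_def sign_reflections_def)
  have "\<bar>real_of_int (Poly_Mapping.lookup b i)\<bar> = x $ i" for i
  proof -
    have "real_of_int (Poly_Mapping.lookup b i) = e $ i * x $ i"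
      using b by (simp add: vec_eq_iff)
    then show ?thesis using e[of i] nonneg[OF x, of i] by auto
  qed
  then have "(\<chi> i. real_of_int (Poly_Mapping.lookup (abs_exp b) i)) = x"
    by (simp add: vec_eq_iff)
  with x show "b \<in> abs_exp -` lattice_points P" by (simp add: lattice_points_def)
next
  fix b assume "b \<in> abs_exp -` lattice_points P"
  then have "(\<chi> i. real_of_int \<bar>Poly_Mapping.lookup b i\<bar>) \<in> P"
    by (simp add: lattice_points_def)
  \<comment> \<open>The sign vector consists of the signs of \<open>b\<close>, with 1 chosen at zero
    coordinates since the entry 0 is not allowed.\<close>
  moreover have "(\<chi> i. real_of_int (Poly_Mapping.lookup b i)) =
      (\<chi> i. (\<chi> i. if Poly_Mapping.lookup b i < 0 then - 1 else 1) $ i *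
        (\<chi> i. real_of_int \<bar>Poly_Mapping.lookup b i\<bar>) $ i)"
    by (simp add: vec_eq_iff)
  ultimately show "b \<in> lattice_points (sign_reflections P)"
    unfolding lattice_points_def sign_reflections_def
    by (intro CollectI exI conjI) (assumption | simp)+
qed

lemma bounded_sign_reflections:
  fixes P :: "(real ^ 'n) set"
  assumes "bounded P"
  shows "bounded (sign_reflections P)"
proof -
  obtain r where r: "\<And>x. x \<in> P \<Longrightarrow> norm x \<le> r"
    using assms by (auto simp: bounded_iff)
  have "norm (\<chi> i. e $ i * x $ i) = norm x" if "\<forall>i. e $ i \<in> {-1, 1 :: real}" for e x :: "real ^ 'n"
  proof -
    have "\<bar>e $ i\<bar> = 1" for i using that[rule_format, of i] by auto
    then show ?thesis by (simp add: norm_vec_def abs_mult)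
  qed
  with r show ?thesis
    unfolding bounded_iff sign_reflections_def by (intro exI[of _ r]) force
qed

lemma finite_lattice_points:
  fixes Q :: "(real ^ 'n::{finite,linorder}) set"
  assumes "bounded Q"
  shows "finite (lattice_points Q)"
proof -
  obtain r where r: "\<And>x. x \<in> Q \<Longrightarrow> norm x \<le> r"
    using assms by (auto simp: bounded_iff)
  have "Poly_Mapping.lookup ` lattice_points Q \<subseteq> (UNIV \<rightarrow>\<^sub>E {- \<lceil>r\<rceil>..\<lceil>r\<rceil>})"
  proof (intro image_subsetI PiE_I)
    fix a i assume "a \<in> lattice_points Q"
    then have "norm (\<chi> i. real_of_int (Poly_Mapping.lookup a i)) \<le> r"
      by (auto simp: lattice_points_def intro: r)
    then have "\<bar>real_of_int (Poly_Mapping.lookup a i)\<bar> \<le> r"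
      using component_le_norm_cart[of "\<chi> i. real_of_int (Poly_Mapping.lookup a i)" i] by simp
    then show "Poly_Mapping.lookup a i \<in> {- \<lceil>r\<rceil>..\<lceil>r\<rceil>}"
      unfolding atLeastAtMost_iff by linarith
  qed simp
  then have "finite (Poly_Mapping.lookup ` lattice_points Q)"
    by (rule finite_subset) (simp add: finite_PiE)
  then show ?thesis
    by (rule finite_imageD) (simp add: inj_on_def lookup_inject)
qed

lemma down_closed_lattice_points:
  fixes P :: "(real ^ 'n::{finite,linorder}) set"
  assumes "anti_blocking_lattice_polytope P"
  shows "down_closed (lattice_points P)"
proof -
  let ?v = "\<lambda>b :: 'n \<Rightarrow>\<^sub>0 int. \<chi> i. real_of_int (Poly_Mapping.lookup b i)"
  have nonneg: "\<And>x i. x \<in> P \<Longrightarrow> 0 \<le> x $ i"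
    and down: "\<And>x y. y \<in> P \<Longrightarrow> \<forall>i. 0 \<le> x $ i \<and> x $ i \<le> y $ i \<Longrightarrow> x \<in> P"
    using assms unfolding anti_blocking_lattice_polytope_def by blast+
  show ?thesis
    unfolding down_closed_def
  proof (intro conjI ballI allI impI)
    fix b i assume "b \<in> lattice_points P"
    then show "0 \<le> Poly_Mapping.lookup b i"
      using nonneg[of "?v b" i] by (simp add: lattice_points_def)
  next
    fix b c
    assume "b \<in> lattice_points P"
      and "\<forall>i. 0 \<le> Poly_Mapping.lookup c i \<and> Poly_Mapping.lookup c i \<le> Poly_Mapping.lookup b i"
    then show "c \<in> lattice_points P"
      using down[of "?v b" "?v c"] by (simp add: lattice_points_def)
  qed
qed

text \<open>Full dimension yields a vertex with nonzero i-th coordinate; being a nonnegative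
  integer, that coordinate is at least 1, so the unit vector lies below the vertex.\<close>

lemma unit_vector_in_anti_blocking:
  fixes P :: "(real ^ 'n::{finite,linorder}) set"
  assumes P: "anti_blocking_lattice_polytope P"
  shows "frag_of i \<in> lattice_points P"
proof -
  have poly: "polytope P" and int: "\<And>v j. v extreme_point_of P \<Longrightarrow> v $ j \<in> \<int>"
    and dim: "aff_dim P = int CARD('n)" and nonneg: "\<And>x j. x \<in> P \<Longrightarrow> 0 \<le> x $ j"
    and down: "\<And>x y. y \<in> P \<Longrightarrow> (\<And>j. 0 \<le> x $ j \<and> x $ j \<le> y $ j) \<Longrightarrow> x \<in> P"
    using P unfolding anti_blocking_lattice_polytope_def lattice_polytope_def by blast+
  have "\<exists>v. v extreme_point_of P \<and> v $ i \<noteq> 0"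
  proof (rule ccontr)
    assume "\<not> ?thesis"
    then have "{v. v extreme_point_of P} \<subseteq> {x. axis i 1 \<bullet> x = 0}"
      by (auto simp: inner_axis')
    \<comment> \<open>Otherwise the polytope, as the hull of its vertices, would lie in a coordinate
      hyperplane, of dimension one too small.\<close>
    then have "convex hull {v. v extreme_point_of P} \<subseteq> {x. axis i 1 \<bullet> x = 0}"
      by (intro hull_minimal convex_hyperplane)
    moreover have "P = convex hull {v. v extreme_point_of P}"
      using poly by (intro Krein_Milman_Minkowski polytope_imp_compact polytope_imp_convex)
    ultimately have "P \<subseteq> {x. axis i 1 \<bullet> x = 0}" by simp
    then have "aff_dim P \<le> aff_dim {x. axis i (1::real) \<bullet> x = 0}"
      by (rule aff_dim_subset)
    also have "\<dots> = int CARD('n) - 1"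
      by (subst aff_dim_hyperplane) (auto simp: axis_eq_0_iff)
    finally show False using dim by simp
  qed
  then obtain v where v: "v extreme_point_of P" "v $ i \<noteq> 0" by blast
  then have vP: "v \<in> P" by (simp add: extreme_point_of_def)
  obtain n where n: "v $ i = of_int n" using int[OF v(1)] by (auto elim: Ints_cases)
  with v(2) nonneg[OF vP, of i] have "1 \<le> v $ i" by auto
  then have "(\<chi> j. real_of_int (Poly_Mapping.lookup (frag_of i) j)) \<in> P"
    using nonneg[OF vP] by (intro down[OF vP]) auto
  then show ?thesis by (simp add: lattice_points_def)
qed

theorem theorem1p1:
  fixes P :: "(real ^ 'n::{finite,linorder}) set"
  assumes "anti_blocking_lattice_polytope P"
  shows "normal_domain (toric_ring P :: ('n, 'k::field) laurent poly set) \<longleftrightarrow>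
         normal_domain (toric_ring (sign_reflections P) :: ('n, 'k) laurent poly set)"
proof -
  have poly: "polytope P" and nonneg: "\<And>x i. x \<in> P \<Longrightarrow> 0 \<le> x $ i"
    using assms unfolding anti_blocking_lattice_polytope_def lattice_polytope_def by blast+
  let ?L = "lattice_points P"
  have down: "down_closed ?L" by (rule down_closed_lattice_points[OF assms])
  have eq: "lattice_points (sign_reflections P) = abs_exp -` ?L"
    by (rule lattice_points_sign_reflections) (rule nonneg)
  have unit: "frag_of i \<in> ?L" for i by (rule unit_vector_in_anti_blocking[OF assms])
  \<comment> \<open>The origin lies below any unit vector, so the index is arbitrary.\<close>
  have zero: "0 \<in> ?L"
    by (rule down_closedD[OF down unit[of undefined]]) (auto simp: lookup_frag_of)
  \<comment> \<open>Nonnegative vectors are fixed by \<open>abs_exp\<close>, so the origin and the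
    unit vectors are lattice points of the reflected polytope too.\<close>
  have abs: "abs_exp 0 = (0 :: 'n \<Rightarrow>\<^sub>0 int)" "abs_exp (frag_of i) = frag_of i" for i :: 'n
    by (auto intro!: abs_exp_eq)
  have fin: "finite ?L"
    by (intro finite_lattice_points polytope_imp_bounded poly)
  have fin': "finite (lattice_points (sign_reflections P))"
    by (intro finite_lattice_points bounded_sign_reflections polytope_imp_bounded poly)
  show ?thesis
    using normal_toric_ring_iff_saturated[OF fin zero unit, where 'k = 'k]
      normal_toric_ring_iff_saturated[OF fin', where 'k = 'k]
      saturated_abs_exp_vimage[OF down] abs zero unit
    unfolding eq by simp
qed

end
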